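(* Let $S$ be a symmetry group in dimension $d$, let $(G,p)\in\mathscr{R}_{(G,S)}$ be a framework in $\mathbb{E}^d$ with $n$ joints, and let $q$ be a configuration of $n+1$ points (including the origin, as the position of the cone joint $o$) in Minkowskian space $\mathbb{M}^{d+1}$ such that $(G*o,q)\in\mathscr{R}^{\mathbb{M}}_{(G*o,S^* )}$ and such that the projection $\pi(q)$ from the origin onto the hyperplane $x_{d+1}=1$ and then back to $\mathbb{E}^d$ is equal to $p \in \mathbb{E}^{dn}$. Then: (i) the space of $S$-symmetric infinitesimal motions of $(G,p)$ in $\mathbb{E}^{d}$ is isomorphic to the space of $S^{*}$-symmetric infinitesimal motions of $(G*o,q)$ in $\mathbb{M}^{d+1}$ with the cone joint of $(G*o,q)$ fixed at the origin; (ii) the space of $S$-symmetric trivial infinitesimal motions of $(G,p)$ in $\mathbb{E}^{d}$ is isomorphic to the space of $S^{*}$-symmetric trivial infinitesimal motions of $(G*o,q)$ in $\mathbb{M}^{d+1}$ with the cone joint of $(G*o,q)$ fixed at the origin; (iii) $(G,p)$ has a non-trivial $S$-symmetric infinitesimal motion in $\mathbb{E}^{d}$ if and only if $(G*o,q)$ has a non-trivial $S^{*}$-symmetric infinitesimal motion in $\mathbb{M}^{d+1}$; (iv) the space of $S$-symmetric self-stresses of $(G,p)$ in $\mathbb{E}^{d}$ is isomorphic to the space of $S^{*}$-symmetric self-stresses of $(G*o,q)$ in $\mathbb{M}^{d+1}$.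
   Context: A framework $(G,p)$ in $\mathbb{E}^d$ is a finite simple graph $G$ with vertex set $V(G)=\{1,\dots,n\}$ and edge set $E(G)$, together with an injective map $p:V(G)\to\mathbb{E}^d$; $p_i=p(i)$. An infinitesimal motion of $(G,p)$ is a map $u:V(G)\to\mathbb{E}^d$ with $(p_i-p_j)\cdot(u_i-u_j)=0$ for all $\{i,j\}\in E(G)$. It is trivial if $u_i=Ap_i+t$ for all $i$, for some skew-symmetric matrix $A$ and vector $t$; otherwise non-trivial. A self-stress is a function $\omega:E(G)\to\mathbb{R}$ with $\sum_{j:\{i,j\}\in E(G)}\omega_{ij}(p_i-p_j)=0$ for every vertex $i$. A symmetry group in dimension $d$ is a subgroup $S$ of $O(\mathbb{E}^d)$. $\mathscr{R}_{(G,S)}$ is the set of frameworks $(G,p)$ in $\mathbb{E}^d$ for which there is a map $\Phi:S\to\mathrm{Aut}(G)$ with $x(p_i)=p_{\Phi(x)(i)}$ for all $i\in V(G)$, $x\in S$ ($\Phi$ is unique and a homomorphism since $p$ is injective); write $x(i)$ for $\Phi(x)(i)$. An infinitesimal motion $u$ is $S$-symmetric if $x(u_i)=u_{x(i)}$ for all $i$ and all $x\in S$. A self-stress is $S$-symmetric if it is constant on the orbits of edges under $S$. $\mathbb{M}^{d+1}$ is $\mathbb{R}^{d+1}$ with $\|a\|^2_{\mathbb{M}}=a_1^2+\dots+a_d^2-a_{d+1}^2$ and associated bilinear form $\langle a,b\rangle_{\mathbb{M}}=a_1b_1+\dots+a_db_d-a_{d+1}b_{d+1}$. Frameworks $(H,q)$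 in $\mathbb{M}^{d+1}$ are defined as in Euclidean space (distinct joints). An infinitesimal motion of $(H,q)$ in $\mathbb{M}^{d+1}$ is $u:V(H)\to\mathbb{R}^{d+1}$ with $\langle q_i-q_j,u_i-u_j\rangle_{\mathbb{M}}=0$ for all edges $\{i,j\}$; it is trivial if $u_i=Aq_i+t$ for all $i$, with $t\in\mathbb{R}^{d+1}$ and $A$ satisfying $\langle Aa,b\rangle_{\mathbb{M}}+\langle a,Ab\rangle_{\mathbb{M}}=0$ for all $a,b$. A self-stress is $\omega:E(H)\to\mathbb{R}$ with $\sum_{j}\omega_{ij}(\hat q_i-\hat q_j)=0$ at every vertex $i$, where $\hat a=(a_1,\dots,a_d,-a_{d+1})$. For $x\in S$ with matrix $M_x$, $x^*$ is the isometry of $\mathbb{M}^{d+1}$ with matrix $\begin{pmatrix}M_x&0\\0&1\end{pmatrix}$, and $S^*=\{x^*:x\in S\}$. $\mathscr{R}^{\mathbb{M}}_{(H,S^* )}$ and $S^*$-symmetric motions and self-stresses are defined as in the Euclidean case. The cone graph $G*o$ is $G$ with a new vertex $o$ joined to all vertices of $G$; in $(G*o,q)$ the joint $o$ is at the origin. The condition $\pi(q)=p$ means that for each $i\in V(G)$ there is a scalar $\alpha_i\ne0$ with $q_i=\alpha_i(p_i,1)$. "With the cone joint fixed at the origin" means only motions with $u_o=0$ are considered. *)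

theory Defs
  imports "HOL-Analysis.Analysis" "HOL-Algebra.Group"
begin

text \<open>
  Conventions. A finite simple graph has the elements of a type of class finite as
  its vertices and is given by its edge set, a set of two-element sets of vertices.
  Configurations and velocity assignments are vectors indexed by vertices, edge
  weights are vectors indexed by vertex sets. Minkowskian space of dimension one more
  than the Euclidean space is the product of the Euclidean space with the real line,
  the second component being the last coordinate.
\<close>

section \<open>Graphs\<close>

definition simple_graph :: "'v::finite set set \<Rightarrow> bool" where
  "simple_graph E \<longleftrightarrow> (\<forall>e\<in>E. card e = 2)"

definition automorphisms :: "'v::finite set set \<Rightarrow> ('v \<Rightarrow> 'v) set" where
  "automorphisms E = {\<pi>. bij \<pi> \<and> (\<forall>i j. {i, j} \<in> E \<longleftrightarrow> {\<pi> i, \<pi> j} \<in> E)}"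

text \<open>The cone vertex is \<^term>\<open>None\<close>.\<close>

definition cone_graph :: "'v::finite set set \<Rightarrow> 'v option set set" where
  "cone_graph E = (\<lambda>e. Some ` e) ` E \<union> range (\<lambda>i. {Some i, None})"

lemma simple_graph_cone: "simple_graph E \<Longrightarrow> simple_graph (cone_graph E)"
  by (auto simp: simple_graph_def cone_graph_def card_image)

section \<open>Symmetric frameworks\<close>

text \<open>The definitions of this section serve both the Euclidean and the Minkowskian case.\<close>

definition framework :: "'v::finite set set \<Rightarrow> 'a^'v \<Rightarrow> bool" where
  "framework E p \<longleftrightarrow> simple_graph E \<and> inj (\<lambda>i. p $ i)"

definition symmetry_action ::
  "'v::finite set set \<Rightarrow> ('a \<Rightarrow> 'a) set \<Rightarrow> 'a^'v \<Rightarrow> (('a \<Rightarrow> 'a) \<Rightarrow> 'v \<Rightarrow> 'v) \<Rightarrow> bool" where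
  "symmetry_action E S p \<Phi> \<longleftrightarrow>
     (\<forall>x\<in>S. \<Phi> x \<in> automorphisms E \<and> (\<forall>i. x (p $ i) = p $ (\<Phi> x i)))"

definition symmetric_frameworks ::
  "'v::finite set set \<Rightarrow> ('a \<Rightarrow> 'a) set \<Rightarrow> ('a^'v) set" where
  "symmetric_frameworks E S = {p. framework E p \<and> (\<exists>\<Phi>. symmetry_action E S p \<Phi>)}"

text \<open>The choice below is unique on the symmetry group, by the lemma that follows.\<close>

definition action ::
  "'v::finite set set \<Rightarrow> ('a \<Rightarrow> 'a) set \<Rightarrow> 'a^'v \<Rightarrow> ('a \<Rightarrow> 'a) \<Rightarrow> 'v \<Rightarrow> 'v" where
  "action E S p = (SOME \<Phi>. symmetry_action E S p \<Phi>)"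

lemma symmetry_action_unique:
  assumes "framework E p" "symmetry_action E S p \<Phi>" "x \<in> S"
  shows "action E S p x = \<Phi> x"
proof
  fix i
  have "symmetry_action E S p (action E S p)"
    unfolding action_def using someI[of "symmetry_action E S p", OF assms(2)] by simp
  then have "p $ (action E S p x i) = p $ (\<Phi> x i)"
    using assms(2,3) by (metis symmetry_action_def)
  then show "action E S p x i = \<Phi> x i"
    using assms(1) by (simp add: framework_def inj_def)
qed

definition symmetric_motion ::
  "'v::finite set set \<Rightarrow> ('a \<Rightarrow> 'a) set \<Rightarrow> 'a^'v \<Rightarrow> 'a^'v \<Rightarrow> bool" where
  "symmetric_motion E S p u \<longleftrightarrow> (\<forall>x\<in>S. \<forall>i. x (u $ i) = u $ (action E S p x i))"

definition edge_orbit ::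
  "'v::finite set set \<Rightarrow> ('a \<Rightarrow> 'a) set \<Rightarrow> 'a^'v \<Rightarrow> 'v set \<Rightarrow> 'v set set" where
  "edge_orbit E S p e = {action E S p x ` e | x. x \<in> S}"

definition symmetric_stress ::
  "'v::finite set set \<Rightarrow> ('a \<Rightarrow> 'a) set \<Rightarrow> 'a^'v \<Rightarrow> real^('v set) \<Rightarrow> bool" where
  "symmetric_stress E S p \<omega> \<longleftrightarrow> (\<forall>e\<in>E. \<forall>f\<in>edge_orbit E S p e. \<omega> $ f = \<omega> $ e)"

section \<open>Euclidean frameworks\<close>

definition orthogonal_group :: "(real^'d \<Rightarrow> real^'d) monoid" where
  "orthogonal_group = \<lparr>carrier = Collect orthogonal_transformation, mult = (\<circ>), one = id\<rparr>"

lemma group_orthogonal_group: "group orthogonal_group"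
proof (rule groupI)
  fix x :: "real^'d \<Rightarrow> real^'d"
  assume "x \<in> carrier orthogonal_group"
  then have x: "orthogonal_transformation x"
    by (simp add: orthogonal_group_def)
  show "\<exists>y\<in>carrier orthogonal_group. y \<otimes>\<^bsub>orthogonal_group\<^esub> x = \<one>\<^bsub>orthogonal_group\<^esub>"
    using orthogonal_transformation_inv[OF x] orthogonal_transformation_inj[OF x]
    by (intro bexI[of _ "inv_into UNIV x"]) (auto simp: orthogonal_group_def)
qed (auto simp: orthogonal_group_def orthogonal_transformation_compose
      orthogonal_transformation_id[unfolded id_def[symmetric]])

definition motion :: "'v::finite set set \<Rightarrow> (real^'d)^'v \<Rightarrow> (real^'d)^'v \<Rightarrow> bool" where
  "motion E p u \<longleftrightarrow> (\<forall>i j. {i, j} \<in> E \<longrightarrow> (p $ i - p $ j) \<bullet> (u $ i - u $ j) = 0)"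

definition trivial_motion :: "(real^'d)^'v::finite \<Rightarrow> (real^'d)^'v \<Rightarrow> bool" where
  "trivial_motion p u \<longleftrightarrow>
     (\<exists>(A :: real^'d^'d) t. transpose A = - A \<and> (\<forall>i. u $ i = A *v (p $ i) + t))"

text \<open>
  A weight function on the edges is represented by its extension by zero to all sets
  of vertices.
\<close>

definition self_stress :: "'v::finite set set \<Rightarrow> (real^'d)^'v \<Rightarrow> real^('v set) \<Rightarrow> bool" where
  "self_stress E p \<omega> \<longleftrightarrow> (\<forall>e. e \<notin> E \<longrightarrow> \<omega> $ e = 0) \<and>
     (\<forall>i. (\<Sum>j | {i, j} \<in> E. \<omega> $ {i, j} *\<^sub>R (p $ i - p $ j)) = 0)"

definition symmetric_motions ::
  "'v::finite set set \<Rightarrow> (real^'d \<Rightarrow> real^'d) set \<Rightarrow> (real^'d)^'v \<Rightarrow> ((real^'d)^'v) set" where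
  "symmetric_motions E S p = {u. motion E p u \<and> symmetric_motion E S p u}"

definition symmetric_stresses ::
  "'v::finite set set \<Rightarrow> (real^'d \<Rightarrow> real^'d) set \<Rightarrow> (real^'d)^'v \<Rightarrow> (real^('v set)) set" where
  "symmetric_stresses E S p = {\<omega>. self_stress E p \<omega> \<and> symmetric_stress E S p \<omega>}"

section \<open>Minkowskian frameworks\<close>

type_synonym 'd mink = "(real^'d) \<times> real"

definition mink_form :: "'d::finite mink \<Rightarrow> 'd mink \<Rightarrow> real" where
  "mink_form a b = fst a \<bullet> fst b - snd a * snd b"

definition mink_hat :: "'d::finite mink \<Rightarrow> 'd mink" where
  "mink_hat a = (fst a, - snd a)"

definition star :: "(real^'d \<Rightarrow> real^'d) \<Rightarrow> 'd::finite mink \<Rightarrow> 'd mink" where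
  "star x = map_prod x id"

definition mink_motion :: "'v::finite set set \<Rightarrow> ('d::finite mink)^'v \<Rightarrow> ('d mink)^'v \<Rightarrow> bool" where
  "mink_motion E q u \<longleftrightarrow>
     (\<forall>i j. {i, j} \<in> E \<longrightarrow> mink_form (q $ i - q $ j) (u $ i - u $ j) = 0)"

definition mink_trivial_motion :: "('d::finite mink)^'v::finite \<Rightarrow> ('d mink)^'v \<Rightarrow> bool" where
  "mink_trivial_motion q u \<longleftrightarrow>
     (\<exists>A t. linear A \<and> (\<forall>a b. mink_form (A a) b + mink_form a (A b) = 0) \<and>
            (\<forall>i. u $ i = A (q $ i) + t))"

definition mink_self_stress ::
  "'v::finite set set \<Rightarrow> ('d::finite mink)^'v \<Rightarrow> real^('v set) \<Rightarrow> bool" where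
  "mink_self_stress E q \<omega> \<longleftrightarrow> (\<forall>e. e \<notin> E \<longrightarrow> \<omega> $ e = 0) \<and>
     (\<forall>i. (\<Sum>j | {i, j} \<in> E. \<omega> $ {i, j} *\<^sub>R (mink_hat (q $ i) - mink_hat (q $ j))) = 0)"

definition mink_symmetric_motions ::
  "'v::finite set set \<Rightarrow> ('d::finite mink \<Rightarrow> 'd mink) set \<Rightarrow> ('d mink)^'v \<Rightarrow> (('d mink)^'v) set" where
  "mink_symmetric_motions E S q = {u. mink_motion E q u \<and> symmetric_motion E S q u}"

definition mink_symmetric_stresses ::
  "'v::finite set set \<Rightarrow> ('d::finite mink \<Rightarrow> 'd mink) set \<Rightarrow> ('d mink)^'v \<Rightarrow> (real^('v set)) set" where
  "mink_symmetric_stresses E S q = {\<omega>. mink_self_stress E q \<omega> \<and> symmetric_stress E S q \<omega>}"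

text \<open>Only the joints other than the cone joint are projected.\<close>

definition projects_to :: "('d::finite mink)^('v::finite option) \<Rightarrow> (real^'d)^'v \<Rightarrow> bool" where
  "projects_to q p \<longleftrightarrow> (\<forall>i. \<exists>\<alpha>. \<alpha> \<noteq> 0 \<and> q $ Some i = \<alpha> *\<^sub>R (p $ i, 1))"

section \<open>Isomorphic spaces\<close>

text \<open>
  A linear map defined only on the subspace always extends to the whole space, so
  requiring a linear map on the ambient space is no restriction.
\<close>

definition isomorphic_spaces :: "'a::real_vector set \<Rightarrow> 'b::real_vector set \<Rightarrow> bool" where
  "isomorphic_spaces U W \<longleftrightarrow>
     subspace U \<and> subspace W \<and> (\<exists>f. linear f \<and> bij_betw f U W)"

end

theory Submission
  imports Defs
begin

text \<open>
  Write \<open>q\<^sub>i = \<alpha>\<^sub>i (p\<^sub>i, 1)\<close>. Comparing last coordinates, the symmetry of \<open>q\<close> forces \<open>\<alpha>\<close> to be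
  constant on the orbits of vertices, and the group acts on the cone graph by its action on
  the base graph, with the cone vertex fixed (\<open>cone_action\<close>, \<open>scale_invariant\<close>).

  Motions. The edge from the origin to \<open>q\<^sub>i\<close> forces a velocity at \<open>q\<^sub>i\<close> to be
  Minkowski-orthogonal to \<open>(p\<^sub>i, 1)\<close>, that is, to be of the form \<open>\<alpha>\<^sub>i (u\<^sub>i, p\<^sub>i \<bullet> u\<^sub>i)\<close>. With
  velocities \<open>v\<^sub>i\<close> of this form, the quantity \<open>\<langle>q\<^sub>i - q\<^sub>j, v\<^sub>i - v\<^sub>j\<rangle>\<close> equals
  \<open>\<alpha>\<^sub>i \<alpha>\<^sub>j (p\<^sub>i - p\<^sub>j) \<bullet> (u\<^sub>i - u\<^sub>j)\<close>, so \<open>u \<mapsto> v\<close> is an isomorphism of the spaces of motions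
  (\<open>bij_betw_cone_velocity\<close>). It preserves and reflects triviality because the
  Minkowski-skew linear maps are exactly the maps \<open>(a, s) \<mapsto> (A a + s t, a \<bullet> t)\<close> with \<open>A\<close>
  skew-symmetric (\<open>mink_skew_iff\<close>), and such a map sends \<open>\<alpha>\<^sub>i (p\<^sub>i, 1)\<close> to the velocity
  corresponding to \<open>A p\<^sub>i + t\<close>. A motion that moves the cone joint is reduced to one that
  does not by subtracting a translation, which is symmetric since the cone vertex is fixed.

  Stresses. Equilibrium of \<open>w\<close> at \<open>q\<^sub>i\<close> has two components. The last one determines the
  weight of the cone edge at \<open>i\<close> from the weights of the base edges; substituted into the
  first, it leaves \<open>\<Sum>\<^sub>j w\<^sub>i\<^sub>j \<alpha>\<^sub>j (p\<^sub>i - p\<^sub>j) = 0\<close>, so \<open>\<omega>\<^sub>i\<^sub>j = \<alpha>\<^sub>i \<alpha>\<^sub>j w\<^sub>i\<^sub>j\<close> is a stress of \<open>p\<close>.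
  Equilibrium at the cone joint is automatic, because the forces along the base edges
  cancel in pairs (\<open>bij_betw_cone_stress\<close>).
\<close>

section \<open>Linear algebra\<close>

lemma isomorphic_spacesI:
  assumes "subspace U" "linear f" "bij_betw f U W"
  shows "isomorphic_spaces U W"
  using assms linear_subspace_image[of f U]
  unfolding isomorphic_spaces_def bij_betw_def by metis

lemma skew_matrix_inner:
  fixes A :: "real^'d^'d"
  assumes "transpose A = - A"
  shows "(A *v a) \<bullet> b = - (a \<bullet> (A *v b))"
proof -
  have "(A *v a) \<bullet> b = a \<bullet> (transpose A *v b)"
    by (metis dot_lmul_matrix transpose_transpose transpose_matrix_vector)
  then show ?thesis
    by (simp add: assms matrix_vector_mult_def vec_eq_iff inner_vec_def sum_negf)
qed

lemma skew_matrix_of_linear: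
  fixes F :: "real^'d \<Rightarrow> real^'d"
  assumes "linear F" "\<And>a b. F a \<bullet> b + a \<bullet> F b = 0"
  shows "transpose (matrix F) = - matrix F"
proof -
  have skew: "F (axis i 1) $ j = - F (axis j 1) $ i" for i j
  proof -
    have "F (axis i 1) $ j + F (axis j 1) $ i = F (axis i 1) \<bullet> axis j 1 + axis i 1 \<bullet> F (axis j 1)"
      by (simp add: inner_axis inner_axis')
    then show ?thesis
      by (simp only: assms(2) eq_neg_iff_add_eq_0)
  qed
  have "transpose (matrix F) $ i $ j = (- matrix F) $ i $ j" for i j
    using skew[of i j] by (simp add: transpose_def matrix_def)
  then show ?thesis
    by (simp add: vec_eq_iff)
qed

text \<open>
  The Lie algebra of the Lorentz group: a Minkowski-skew linear map is given by a
  skew-symmetric block \<open>A\<close> (infinitesimal rotation) and a vector \<open>t\<close> (infinitesimal boost),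
  which is both its last column and its last row.
\<close>

lemma mink_skew_iff:
  fixes B :: "'d::finite mink \<Rightarrow> 'd mink"
  shows "linear B \<and> (\<forall>a b. mink_form (B a) b + mink_form a (B b) = 0) \<longleftrightarrow>
    (\<exists>(A :: real^'d^'d) t. transpose A = - A \<and> (\<forall>a s. B (a, s) = (A *v a + s *\<^sub>R t, a \<bullet> t)))"
  (is "?lhs \<longleftrightarrow> ?rhs")
proof
  assume L: ?lhs
  then have lin: "linear B" and skew: "\<And>a b. mink_form (B a) b + mink_form a (B b) = 0"
    by blast+
  define F where "F a = fst (B (a, 0))" for a
  define t where "t = fst (B (0, 1))"
  have linF: "linear F"
    unfolding F_def
    using linear_add[OF lin] linear_scale[OF lin]
    by (intro linearI) (metis add.right_neutral add_Pair fst_add,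
        metis scaleR_Pair fst_scaleR scaleR_zero_right)
  have "F a \<bullet> b + a \<bullet> F b = 0" for a b
    using skew[of "(a, 0)" "(b, 0)"] by (simp add: mink_form_def F_def)
  then have skewF: "transpose (matrix F) = - matrix F"
    by (rule skew_matrix_of_linear[OF linF])
  have snd0: "snd (B (a, 0)) = a \<bullet> t" for a
    using skew[of "(a, 0)" "(0, 1)"] by (simp add: mink_form_def t_def)
  have snd1: "snd (B (0, 1)) = 0"
    using skew[of "(0, 1)" "(0, 1)"] by (simp add: mink_form_def)
  have "B (a, s) = (matrix F *v a + s *\<^sub>R t, a \<bullet> t)" for a s
  proof -
    have "B (a, s) = B ((a, 0) + s *\<^sub>R (0, 1))"
      by simp
    also have "\<dots> = B (a, 0) + s *\<^sub>R B (0, 1)"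
      by (simp only: linear_add[OF lin] linear_scale[OF lin])
    also have "\<dots> = (F a + s *\<^sub>R t, a \<bullet> t)"
      by (simp add: prod_eq_iff snd0 snd1 F_def t_def)
    finally show ?thesis
      using linF by (simp add: matrix_works linear_matrix_vector_mul_eq)
  qed
  with skewF show ?rhs by blast
next
  assume ?rhs
  then obtain A :: "real^'d^'d" and t
    where A: "transpose A = - A" and B: "\<And>a s. B (a, s) = (A *v a + s *\<^sub>R t, a \<bullet> t)"
    by blast
  have "linear B"
    by (rule linearI)
      (auto simp: B algebra_simps matrix_vector_right_distrib matrix_vector_mult_scaleR
        inner_add_left)
  moreover have "mink_form (B a) b + mink_form a (B b) = 0" for a b
    using skew_matrix_inner[OF A, of "fst a" "fst b"] B[of "fst a" "snd a"] B[of "fst b" "snd b"]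
    by (simp add: mink_form_def inner_add_left inner_add_right inner_commute[of t])
  ultimately show ?lhs by blast
qed

section \<open>Symmetric frameworks and their cones\<close>

lemma symmetry_action_action:
  assumes "p \<in> symmetric_frameworks E S"
  shows "symmetry_action E S p (action E S p)"
  using assms someI_ex[of "symmetry_action E S p"]
  by (simp add: symmetric_frameworks_def action_def)

lemma symmetric_stress_iff:
  "symmetric_stress E S p \<omega> \<longleftrightarrow> (\<forall>x\<in>S. \<forall>e\<in>E. \<omega> $ (action E S p x ` e) = \<omega> $ e)"
  by (auto simp: symmetric_stress_def edge_orbit_def)

lemma cone_graph_Some_Some [simp]: "{Some i, Some j} \<in> cone_graph E \<longleftrightarrow> {i, j} \<in> E"
proof -
  have "{i, j} = e" if "{Some i, Some j} = Some ` e" for e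
    using that by (metis image_empty image_insert inj_Some inj_image_eq_iff)
  then show ?thesis
    by (force simp: cone_graph_def image_iff doubleton_eq_iff)
qed

lemma cone_graph_Some_None [simp]:
  "{Some i, None} \<in> cone_graph E" "{None, Some i} \<in> cone_graph E"
  by (auto simp: cone_graph_def insert_commute)

lemma cone_graph_None [simp]: "{None} \<notin> cone_graph E"
  by (auto simp: cone_graph_def)

lemma cone_graph_without_None:
  "None \<notin> e \<Longrightarrow> e \<in> cone_graph E \<longleftrightarrow> Some -` e \<in> E"
proof -
  assume "None \<notin> e"
  then have e: "e = Some ` (Some -` e)"
    by (auto simp: image_iff) (metis option.exhaust)
  have "e \<noteq> {Some i, None}" for i
    using \<open>None \<notin> e\<close> by blast
  then have "e \<in> cone_graph E \<longleftrightarrow> (\<exists>f\<in>E. e = Some ` f)"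
    by (auto simp: cone_graph_def)
  also have "\<dots> \<longleftrightarrow> Some -` e \<in> E"
    using e by (metis inj_Some inj_vimage_image_eq)
  finally show ?thesis .
qed

lemma cone_graph_with_None: "None \<in> e \<Longrightarrow> e \<in> cone_graph E \<longleftrightarrow> (\<exists>i. e = {Some i, None})"
  by (auto simp: cone_graph_def)

lemma sum_cone_neighbours:
  fixes F :: "'v::finite option \<Rightarrow> 'b::comm_monoid_add"
  shows "(\<Sum>k | {Some i, k} \<in> cone_graph E. F k) = F None + (\<Sum>j | {i, j} \<in> E. F (Some j))"
proof -
  have "{k. {Some i, k} \<in> cone_graph E} = insert None (Some ` {j. {i, j} \<in> E})"
    by (auto simp: image_iff) (metis cone_graph_Some_Some option.exhaust)
  then show ?thesis
    by (simp add: sum.reindex)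
qed

text \<open>
  The setting: \<open>p\<close> is a symmetric framework on \<open>E\<close> and \<open>q\<close> is a symmetric framework on the
  cone graph, obtained by moving each point \<open>(p\<^sub>i, 1)\<close> along its line through the origin by
  the nonzero factor \<open>\<alpha>\<^sub>i\<close>.
\<close>

locale coned_framework =
  fixes E :: "'v::finite set set"
    and S :: "(real^'d::finite \<Rightarrow> real^'d) set"
    and p :: "(real^'d)^'v"
    and q :: "('d mink)^('v option)"
    and \<alpha> :: "'v \<Rightarrow> real"
  assumes orthogonal: "x \<in> S \<Longrightarrow> orthogonal_transformation x"
    and base: "p \<in> symmetric_frameworks E S"
    and cone: "q \<in> symmetric_frameworks (cone_graph E) (star ` S)"
    and q_None: "q $ None = 0"
    and q_Some: "q $ Some i = \<alpha> i *\<^sub>R (p $ i, 1)"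
    and scale_nonzero: "\<alpha> i \<noteq> 0"
begin

lemma simple: "simple_graph E"
  and inj_p: "inj (\<lambda>i. p $ i)"
  using base by (auto simp: symmetric_frameworks_def framework_def)

lemma inj_q: "inj (\<lambda>k. q $ k)"
  using cone by (auto simp: symmetric_frameworks_def framework_def)

lemma linear_S: "x \<in> S \<Longrightarrow> linear x"
  and inner_S: "x \<in> S \<Longrightarrow> x a \<bullet> x b = a \<bullet> b"
  using orthogonal by (auto simp: orthogonal_transformation_def)

abbreviation act :: "(real^'d \<Rightarrow> real^'d) \<Rightarrow> 'v \<Rightarrow> 'v" where
  "act \<equiv> action E S p"

abbreviation cone_act :: "('d mink \<Rightarrow> 'd mink) \<Rightarrow> 'v option \<Rightarrow> 'v option" where
  "cone_act \<equiv> action (cone_graph E) (star ` S) q"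

lemma act_point: "x \<in> S \<Longrightarrow> x (p $ i) = p $ act x i"
  and bij_act: "x \<in> S \<Longrightarrow> bij (act x)"
  and act_edge: "x \<in> S \<Longrightarrow> {act x i, act x j} \<in> E \<longleftrightarrow> {i, j} \<in> E"
  using symmetry_action_action[OF base]
  unfolding symmetry_action_def automorphisms_def by blast+

lemma cone_act_point: "x \<in> S \<Longrightarrow> star x (q $ k) = q $ cone_act (star x) k"
  using symmetry_action_action[OF cone] unfolding symmetry_action_def by blast

lemma cone_act_None:
  assumes "x \<in> S"
  shows "cone_act (star x) None = None"
proof -
  have "q $ cone_act (star x) None = q $ None"
    using cone_act_point[OF assms, of None] linear_0[OF linear_S[OF assms]]
    by (simp add: q_None star_def zero_prod_def)
  then show ?thesis
    using inj_q by (simp add: inj_def)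
qed

text \<open>The point \<open>x\<^sup>* q\<^sub>i\<close> has last coordinate \<open>\<alpha>\<^sub>i\<close> and lies on the line through \<open>(x p\<^sub>i, 1)\<close>.\<close>

lemma cone_act_Some:
  assumes "x \<in> S"
  shows "cone_act (star x) (Some i) = Some (act x i) \<and> \<alpha> (act x i) = \<alpha> i"
proof -
  have image: "q $ cone_act (star x) (Some i) = \<alpha> i *\<^sub>R (x (p $ i), 1)"
    using cone_act_point[OF assms, of "Some i"] linear_scale[OF linear_S[OF assms]]
    by (simp add: q_Some star_def)
  then have "cone_act (star x) (Some i) \<noteq> None"
    using q_None scale_nonzero[of i] by (metis scaleR_eq_0_iff snd_conv snd_zero zero_neq_one)
  then obtain m where m: "cone_act (star x) (Some i) = Some m"
    by blast
  have "\<alpha> m = \<alpha> i"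
    using image by (simp add: m q_Some)
  moreover from this have "p $ m = p $ act x i"
    using image scale_nonzero[of i] by (simp add: m q_Some act_point[OF assms])
  then have "m = act x i"
    using inj_p by (simp add: inj_def)
  ultimately show ?thesis
    using m by simp
qed

lemma scale_invariant: "x \<in> S \<Longrightarrow> \<alpha> (act x i) = \<alpha> i"
  using cone_act_Some by blast

lemma cone_action:
  assumes "x \<in> S"
  shows "cone_act (star x) = map_option (act x)"
proof
  show "cone_act (star x) k = map_option (act x) k" for k
    using cone_act_Some[OF assms] cone_act_None[OF assms] by (cases k) simp_all
qed

lemma cone_symmetric_motion_iff:
  "symmetric_motion (cone_graph E) (star ` S) q v \<longleftrightarrow>
    (\<forall>x\<in>S. star x (v $ None) = v $ None \<and> (\<forall>i. star x (v $ Some i) = v $ Some (act x i)))"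
  by (auto simp: symmetric_motion_def cone_action split_option_all)

end

section \<open>Motions\<close>

text \<open>
  The velocities of the joints \<open>\<alpha>\<^sub>i (p\<^sub>i, 1)\<close> corresponding to velocities \<open>u\<^sub>i\<close> of the joints
  \<open>p\<^sub>i\<close>, with the cone joint at rest; \<^term>\<open>mink_form\<close> vanishes on each joint and its velocity.
\<close>

definition cone_velocity ::
  "('v::finite \<Rightarrow> real) \<Rightarrow> (real^'d::finite)^'v \<Rightarrow> (real^'d)^'v \<Rightarrow> ('d mink)^('v option)" where
  "cone_velocity \<alpha> p u =
     (\<chi> k. case k of None \<Rightarrow> 0 | Some i \<Rightarrow> \<alpha> i *\<^sub>R (u $ i, p $ i \<bullet> u $ i))"

text \<open>The inverse correspondence, which forgets the last coordinates.\<close>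

definition base_velocity ::
  "('v::finite \<Rightarrow> real) \<Rightarrow> ('d::finite mink)^('v option) \<Rightarrow> (real^'d)^'v" where
  "base_velocity \<alpha> v = (\<chi> i. fst (v $ Some i) /\<^sub>R \<alpha> i)"

lemma cone_velocity_None [simp]: "cone_velocity \<alpha> p u $ None = 0"
  and cone_velocity_Some [simp]:
    "cone_velocity \<alpha> p u $ Some i = \<alpha> i *\<^sub>R (u $ i, p $ i \<bullet> u $ i)"
  by (simp_all add: cone_velocity_def)

lemma linear_cone_velocity: "linear (cone_velocity \<alpha> p)"
  by (rule linearI)
    (auto simp: vec_eq_iff split_option_all algebra_simps inner_add_right)

context coned_framework
begin

lemma motion_cone_velocity:
  "mink_motion (cone_graph E) q (cone_velocity \<alpha> p u) \<longleftrightarrow> motion E p u"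
proof -
  let ?v = "cone_velocity \<alpha> p u"
  have "mink_form (q $ Some i - q $ Some j) (?v $ Some i - ?v $ Some j) =
      \<alpha> i * \<alpha> j * ((p $ i - p $ j) \<bullet> (u $ i - u $ j))" for i j
    by (simp add: q_Some mink_form_def inner_diff_left inner_diff_right algebra_simps)
  then have "mink_form (q $ Some i - q $ Some j) (?v $ Some i - ?v $ Some j) = 0 \<longleftrightarrow>
      (p $ i - p $ j) \<bullet> (u $ i - u $ j) = 0" for i j
    by (simp add: scale_nonzero)
  moreover have "mink_form (q $ Some i - q $ None) (?v $ Some i - ?v $ None) = 0"
    "mink_form (q $ None - q $ Some i) (?v $ None - ?v $ Some i) = 0" for i
    by (simp_all add: q_Some q_None mink_form_def)
  ultimately show ?thesis
    by (simp add: mink_motion_def motion_def split_option_all del: cone_velocity_Some)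
qed

lemma symmetric_cone_velocity:
  "symmetric_motion (cone_graph E) (star ` S) q (cone_velocity \<alpha> p u) \<longleftrightarrow>
    symmetric_motion E S p u"
proof -
  have "star x (cone_velocity \<alpha> p u $ Some i) = cone_velocity \<alpha> p u $ Some (act x i) \<longleftrightarrow>
      x (u $ i) = u $ act x i" if x: "x \<in> S" for x i
    using inner_S[OF x, of "p $ i" "u $ i"]
    by (auto simp: star_def scale_invariant[OF x] scale_nonzero act_point[OF x]
        linear_scale[OF linear_S[OF x]])
  moreover have "star x 0 = 0" if "x \<in> S" for x
    using linear_0[OF linear_S[OF that]] by (simp add: star_def zero_prod_def)
  ultimately show ?thesis
    unfolding cone_symmetric_motion_iff by (simp add: symmetric_motion_def)
qed

lemma base_cone_velocity: "base_velocity \<alpha> (cone_velocity \<alpha> p u) = u"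
  by (simp add: base_velocity_def vec_eq_iff scale_nonzero)

text \<open>The cone edges determine the last coordinates of the velocities from the others.\<close>

lemma cone_base_velocity:
  assumes "mink_motion (cone_graph E) q v" "v $ None = 0"
  shows "cone_velocity \<alpha> p (base_velocity \<alpha> v) = v"
proof -
  have "p $ i \<bullet> fst (v $ Some i) = snd (v $ Some i)" for i
  proof -
    have "mink_form (q $ Some i) (v $ Some i) = 0"
      using assms cone_graph_Some_None(1)[of i E] unfolding mink_motion_def
      by (metis q_None diff_zero)
    then show ?thesis
      using scale_nonzero[of i] by (simp add: q_Some mink_form_def flip: right_diff_distrib)
  qed
  then show ?thesis
    using assms(2)
    by (simp add: vec_eq_iff split_option_all base_velocity_def prod_eq_iff scale_nonzero)
qed

lemma bij_betw_cone_velocity: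
  "bij_betw (cone_velocity \<alpha> p) (symmetric_motions E S p)
    {v \<in> mink_symmetric_motions (cone_graph E) (star ` S) q. v $ None = 0}"
proof (rule bij_betw_byWitness[where f' = "base_velocity \<alpha>"])
  let ?W = "{v \<in> mink_symmetric_motions (cone_graph E) (star ` S) q. v $ None = 0}"
  show "\<forall>u\<in>symmetric_motions E S p. base_velocity \<alpha> (cone_velocity \<alpha> p u) = u"
    by (simp add: base_cone_velocity)
  show recover: "\<forall>v\<in>?W. cone_velocity \<alpha> p (base_velocity \<alpha> v) = v"
    by (auto simp: mink_symmetric_motions_def cone_base_velocity)
  show "cone_velocity \<alpha> p ` symmetric_motions E S p \<subseteq> ?W"
    by (auto simp: symmetric_motions_def mink_symmetric_motions_def
        motion_cone_velocity symmetric_cone_velocity)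
  show "base_velocity \<alpha> ` ?W \<subseteq> symmetric_motions E S p"
  proof safe
    fix v
    assume v: "v \<in> mink_symmetric_motions (cone_graph E) (star ` S) q" "v $ None = 0"
    then have "cone_velocity \<alpha> p (base_velocity \<alpha> v) = v"
      using recover by blast
    then show "base_velocity \<alpha> v \<in> symmetric_motions E S p"
      using v motion_cone_velocity[of "base_velocity \<alpha> v"]
        symmetric_cone_velocity[of "base_velocity \<alpha> v"]
      by (simp add: symmetric_motions_def mink_symmetric_motions_def)
  qed
qed

lemma trivial_cone_velocity:
  "mink_trivial_motion q (cone_velocity \<alpha> p u) \<longleftrightarrow> trivial_motion p u"
proof
  assume "trivial_motion p u"
  then obtain A :: "real^'d^'d" and t
    where A: "transpose A = - A" and u: "\<And>i. u $ i = A *v (p $ i) + t"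
    by (auto simp: trivial_motion_def)
  define B :: "'d mink \<Rightarrow> 'd mink" where "B = (\<lambda>(a, s). (A *v a + s *\<^sub>R t, a \<bullet> t))"
  have B: "linear B \<and> (\<forall>a b. mink_form (B a) b + mink_form a (B b) = 0)"
    unfolding mink_skew_iff using A by (auto simp: B_def)
  have "p $ i \<bullet> (A *v (p $ i)) = 0" for i
    using skew_matrix_inner[OF A, of "p $ i" "p $ i"] by (simp add: inner_commute)
  then have "cone_velocity \<alpha> p u $ k = B (q $ k) + 0" for k
    by (cases k)
      (simp_all add: q_None q_Some u B_def matrix_vector_mult_scaleR scaleR_add_right
        inner_add_right zero_prod_def)
  with B show "mink_trivial_motion q (cone_velocity \<alpha> p u)"
    unfolding mink_trivial_motion_def by blast
next
  assume "mink_trivial_motion q (cone_velocity \<alpha> p u)"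
  then obtain B c where B: "linear B \<and> (\<forall>a b. mink_form (B a) b + mink_form a (B b) = 0)"
    and v: "\<And>k. cone_velocity \<alpha> p u $ k = B (q $ k) + c"
    unfolding mink_trivial_motion_def by blast
  \<comment> \<open>The cone joint lies at the origin and is at rest, so there is no translational part.\<close>
  have "c = 0"
    using v[of None] linear_0[of B] B by (simp add: q_None)
  moreover obtain A :: "real^'d^'d" and t where A: "transpose A = - A"
    and Bf: "\<And>a s. B (a, s) = (A *v a + s *\<^sub>R t, a \<bullet> t)"
    using B unfolding mink_skew_iff by blast
  ultimately have "\<alpha> i *\<^sub>R u $ i = \<alpha> i *\<^sub>R (A *v (p $ i) + t)" for i
    using v[of "Some i"] by (simp add: q_Some matrix_vector_mult_scaleR scaleR_add_right)
  then have "u $ i = A *v (p $ i) + t" for i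
    using scale_nonzero[of i] by (metis scaleR_cancel_left)
  with A show "trivial_motion p u"
    unfolding trivial_motion_def by blast
qed

lemma bij_betw_cone_velocity_trivial:
  "bij_betw (cone_velocity \<alpha> p) {u \<in> symmetric_motions E S p. trivial_motion p u}
    {v \<in> mink_symmetric_motions (cone_graph E) (star ` S) q.
       mink_trivial_motion q v \<and> v $ None = 0}"
proof (rule bij_betw_subset[OF bij_betw_cone_velocity])
  have image: "{v \<in> mink_symmetric_motions (cone_graph E) (star ` S) q.
        mink_trivial_motion q v \<and> v $ None = 0} =
      {v \<in> cone_velocity \<alpha> p ` symmetric_motions E S p. mink_trivial_motion q v}"
    unfolding bij_betw_imp_surj_on[OF bij_betw_cone_velocity] by auto
  show "cone_velocity \<alpha> p ` {u \<in> symmetric_motions E S p. trivial_motion p u} =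
      {v \<in> mink_symmetric_motions (cone_graph E) (star ` S) q.
        mink_trivial_motion q v \<and> v $ None = 0}"
    unfolding image trivial_cone_velocity[symmetric] by blast
qed auto

lemma subspace_symmetric_motions: "subspace (symmetric_motions E S p)"
proof -
  have "motion E p (u + v)" if "motion E p u" "motion E p v" for u v
  proof -
    have "(p $ i - p $ j) \<bullet> ((u + v) $ i - (u + v) $ j) =
        (p $ i - p $ j) \<bullet> (u $ i - u $ j) + (p $ i - p $ j) \<bullet> (v $ i - v $ j)" for i j
      by (simp add: algebra_simps)
    with that show ?thesis
      by (simp add: motion_def)
  qed
  moreover have "motion E p (c *\<^sub>R u)" if "motion E p u" for c u
    using that by (simp add: motion_def flip: scaleR_diff_right)
  ultimately show ?thesis
    unfolding symmetric_motions_def subspace_def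
    by (auto simp: motion_def symmetric_motion_def linear_0 linear_add linear_scale linear_S)
qed

lemma subspace_trivial_motions: "subspace {u. trivial_motion p u}"
proof (rule subspaceI)
  have "transpose (0 :: real^'d^'d) = - 0"
    by (simp add: transpose_def vec_eq_iff)
  then show "0 \<in> {u. trivial_motion p u}"
    by (auto simp: trivial_motion_def intro!: exI[of _ 0])
next
  fix u v
  assume "u \<in> {u. trivial_motion p u}" "v \<in> {u. trivial_motion p u}"
  then obtain A B :: "real^'d^'d" and s t
    where "transpose A = - A" "\<And>i. u $ i = A *v (p $ i) + s"
      and "transpose B = - B" "\<And>i. v $ i = B *v (p $ i) + t"
    unfolding mem_Collect_eq trivial_motion_def by blast
  moreover have "transpose (A + B) = transpose A + transpose B"
    by (simp add: vec_eq_iff transpose_def)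
  ultimately have "transpose (A + B) = - (A + B)"
    and "\<forall>i. (u + v) $ i = (A + B) *v (p $ i) + (s + t)"
    by (simp_all add: matrix_vector_mult_add_rdistrib)
  then show "u + v \<in> {u. trivial_motion p u}"
    unfolding trivial_motion_def by blast
next
  fix c u
  assume "u \<in> {u. trivial_motion p u}"
  then obtain A :: "real^'d^'d" and t
    where "transpose A = - A" "\<And>i. u $ i = A *v (p $ i) + t"
    unfolding mem_Collect_eq trivial_motion_def by blast
  moreover have "transpose (c *\<^sub>R A) = c *\<^sub>R transpose A"
    by (simp add: vec_eq_iff transpose_def)
  ultimately have "transpose (c *\<^sub>R A) = - (c *\<^sub>R A)"
    and "\<forall>i. (c *\<^sub>R u) $ i = (c *\<^sub>R A) *v (p $ i) + c *\<^sub>R t"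
    by (simp_all add: scaleR_matrix_vector_assoc[symmetric] scaleR_add_right)
  then show "c *\<^sub>R u \<in> {u. trivial_motion p u}"
    unfolding trivial_motion_def by blast
qed

text \<open>A symmetric motion may be translated so that the cone joint is at rest.\<close>

lemma nontrivial_motion_fixing_cone_joint:
  assumes v: "v \<in> mink_symmetric_motions (cone_graph E) (star ` S) q"
    and "\<not> mink_trivial_motion q v"
  obtains w where "w \<in> mink_symmetric_motions (cone_graph E) (star ` S) q"
    "w $ None = 0" "\<not> mink_trivial_motion q w"
proof
  let ?w = "v - (\<chi> k. v $ None)"
  have "star x (a - b) = star x a - star x b" if "x \<in> S" for x a b
    using linear_diff[OF linear_S[OF that]] by (simp add: star_def map_prod_def split_beta)
  moreover from this have "star x 0 = 0" if "x \<in> S" for x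
    using that by (metis diff_self)
  ultimately show "?w \<in> mink_symmetric_motions (cone_graph E) (star ` S) q"
    using v by (auto simp: mink_symmetric_motions_def mink_motion_def cone_symmetric_motion_iff)
  show "?w $ None = 0"
    by simp
  show "\<not> mink_trivial_motion q ?w"
  proof
    assume "mink_trivial_motion q ?w"
    then obtain B c where B: "linear B" "\<forall>a b. mink_form (B a) b + mink_form a (B b) = 0"
      and w: "\<forall>k. ?w $ k = B (q $ k) + c"
      unfolding mink_trivial_motion_def by blast
    have "v $ k = B (q $ k) + (c + v $ None)" for k
    proof -
      have "v $ k = ?w $ k + v $ None"
        by simp
      also have "\<dots> = B (q $ k) + (c + v $ None)"
        by (simp only: w add.assoc)
      finally show ?thesis .
    qed
    with B show False
      using assms(2) unfolding mink_trivial_motion_def by blast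
  qed
qed

lemma nontrivial_motion_iff:
  "(\<exists>u \<in> symmetric_motions E S p. \<not> trivial_motion p u) \<longleftrightarrow>
    (\<exists>v \<in> mink_symmetric_motions (cone_graph E) (star ` S) q. \<not> mink_trivial_motion q v)"
proof -
  have image: "cone_velocity \<alpha> p ` symmetric_motions E S p =
      {v \<in> mink_symmetric_motions (cone_graph E) (star ` S) q. v $ None = 0}"
    using bij_betw_cone_velocity by (rule bij_betw_imp_surj_on)
  show ?thesis
  proof
    assume "\<exists>u \<in> symmetric_motions E S p. \<not> trivial_motion p u"
    then show "\<exists>v \<in> mink_symmetric_motions (cone_graph E) (star ` S) q. \<not> mink_trivial_motion q v"
      using image trivial_cone_velocity by blast
  next
    assume "\<exists>v \<in> mink_symmetric_motions (cone_graph E) (star ` S) q. \<not> mink_trivial_motion q v"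
    then obtain w where "w \<in> mink_symmetric_motions (cone_graph E) (star ` S) q"
      "w $ None = 0" "\<not> mink_trivial_motion q w"
      using nontrivial_motion_fixing_cone_joint by blast
    moreover from this(1,2) obtain u where "u \<in> symmetric_motions E S p" "w = cone_velocity \<alpha> p u"
      using image by blast
    ultimately show "\<exists>u \<in> symmetric_motions E S p. \<not> trivial_motion p u"
      using trivial_cone_velocity by blast
  qed
qed

end

section \<open>Stresses\<close>

text \<open>
  The weight of the cone edge at \<open>i\<close> that balances the last coordinates at \<open>\<alpha>\<^sub>i (p\<^sub>i, 1)\<close>,
  when a base edge \<open>{i, j}\<close> carries the weight \<open>\<omega>\<^sub>i\<^sub>j / (\<alpha>\<^sub>i \<alpha>\<^sub>j)\<close>.
\<close>

definition cone_edge_weight ::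
  "'v::finite set set \<Rightarrow> ('v \<Rightarrow> real) \<Rightarrow> real^('v set) \<Rightarrow> 'v \<Rightarrow> real" where
  "cone_edge_weight E \<alpha> \<omega> i =
     (\<Sum>j | {i, j} \<in> E. \<omega> $ {i, j} / (\<alpha> i * \<alpha> j) * (\<alpha> j - \<alpha> i)) / \<alpha> i"

text \<open>
  The stress of the cone corresponding to \<open>\<omega>\<close>. The sum has one term on the cone edges and
  none on the other sets containing the cone vertex, so that the weight of the latter is zero.
\<close>

definition cone_stress ::
  "'v::finite set set \<Rightarrow> ('v \<Rightarrow> real) \<Rightarrow> real^('v set) \<Rightarrow> real^('v option set)" where
  "cone_stress E \<alpha> \<omega> =
     (\<chi> e. if None \<notin> e then \<omega> $ (Some -` e) / prod \<alpha> (Some -` e)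
           else \<Sum>i | e = {Some i, None}. cone_edge_weight E \<alpha> \<omega> i)"

text \<open>The inverse correspondence, which forgets the cone edges.\<close>

definition base_stress :: "('v::finite \<Rightarrow> real) \<Rightarrow> real^('v option set) \<Rightarrow> real^('v set)" where
  "base_stress \<alpha> w = (\<chi> e. prod \<alpha> e * w $ (Some ` e))"

lemma cone_stress_image_Some [simp]: "cone_stress E \<alpha> \<omega> $ (Some ` e) = \<omega> $ e / prod \<alpha> e"
  by (auto simp: cone_stress_def inj_vimage_image_eq)

lemma cone_stress_Some_None [simp]:
  "cone_stress E \<alpha> \<omega> $ {Some i, None} = cone_edge_weight E \<alpha> \<omega> i"
proof -
  have "{j. {Some i, None} = {Some j, None}} = {i}"
    by (auto simp: doubleton_eq_iff)
  then show ?thesis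
    by (simp add: cone_stress_def)
qed

lemma linear_cone_stress: "linear (cone_stress E \<alpha>)"
proof -
  have "cone_edge_weight E \<alpha> (\<omega> + \<omega>') i =
      cone_edge_weight E \<alpha> \<omega> i + cone_edge_weight E \<alpha> \<omega>' i" for \<omega> \<omega>' i
    by (simp add: cone_edge_weight_def add_divide_distrib distrib_right sum.distrib
        del: mult_divide_mult_cancel_left_if)
  moreover have "cone_edge_weight E \<alpha> (c *\<^sub>R \<omega>) i = c * cone_edge_weight E \<alpha> \<omega> i" for c \<omega> i
    unfolding cone_edge_weight_def times_divide_eq_right sum_distrib_left
    by (simp add: mult.assoc)
  ultimately show ?thesis
    by (intro linearI)
      (auto simp: cone_stress_def vec_eq_iff add_divide_distrib sum.distrib sum_distrib_left)
qed

text \<open>Forces along edges cancel in pairs when summed over all vertices.\<close>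

lemma sum_edge_forces:
  fixes a :: "'v::finite \<Rightarrow> 'b::real_vector"
  shows "(\<Sum>i\<in>UNIV. \<Sum>j | {i, j} \<in> E. w {i, j} *\<^sub>R (a i - a j)) = 0" (is "?s = 0")
proof -
  have "?s = (\<Sum>i\<in>UNIV. \<Sum>j\<in>UNIV. if {i, j} \<in> E then w {i, j} *\<^sub>R (a i - a j) else 0)"
    by (simp add: sum.If_cases)
  also have "\<dots> = (\<Sum>j\<in>UNIV. \<Sum>i\<in>UNIV. if {i, j} \<in> E then w {i, j} *\<^sub>R (a i - a j) else 0)"
    by (rule sum.swap)
  also have "\<dots> = (\<Sum>j\<in>UNIV. \<Sum>i\<in>UNIV. - (if {j, i} \<in> E then w {j, i} *\<^sub>R (a j - a i) else 0))"
    by (intro sum.cong refl) (simp add: insert_commute flip: scaleR_minus_right)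
  also have "\<dots> = - ?s"
    by (simp add: sum_negf sum.If_cases)
  finally have "2 *\<^sub>R ?s = 0"
    by (simp add: scaleR_2 eq_neg_iff_add_eq_0)
  then show ?thesis
    by simp
qed

lemma mink_hat_diff: "mink_hat a - mink_hat b = mink_hat (a - b)"
  and mink_hat_scaleR: "c *\<^sub>R mink_hat a = mink_hat (c *\<^sub>R a)"
  and mink_hat_eq_0 [simp]: "mink_hat a = 0 \<longleftrightarrow> a = 0"
  by (auto simp: mink_hat_def prod_eq_iff)

lemma sum_mink_hat: "(\<Sum>k\<in>K. mink_hat (f k)) = mink_hat (\<Sum>k\<in>K. f k)"
  by (induction K rule: infinite_finite_induct)
    (auto simp: mink_hat_def prod_eq_iff fst_sum snd_sum)

lemma mink_equilibrium_iff:
  "(\<Sum>k\<in>K. c k *\<^sub>R (mink_hat a - mink_hat (f k))) = 0 \<longleftrightarrow> (\<Sum>k\<in>K. c k *\<^sub>R (a - f k)) = 0"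
  by (simp add: mink_hat_diff mink_hat_scaleR sum_mink_hat)

context coned_framework
begin

text \<open>
  Equilibrium in the cone, when the base edges carry the weights \<open>\<omega>\<^sub>i\<^sub>j / (\<alpha>\<^sub>i \<alpha>\<^sub>j)\<close>: the last
  coordinate gives the weights of the cone edges, and the others give equilibrium in the base.
\<close>

lemma cone_equilibrium_iff:
  assumes w: "\<And>j. {i, j} \<in> E \<Longrightarrow> w $ {Some i, Some j} = \<omega> $ {i, j} / (\<alpha> i * \<alpha> j)"
  shows "(\<Sum>k | {Some i, k} \<in> cone_graph E. w $ {Some i, k} *\<^sub>R (q $ Some i - q $ k)) = 0 \<longleftrightarrow>
    w $ {Some i, None} = cone_edge_weight E \<alpha> \<omega> i \<and>
    (\<Sum>j | {i, j} \<in> E. \<omega> $ {i, j} *\<^sub>R (p $ i - p $ j)) = 0"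
  (is "?F = 0 \<longleftrightarrow> ?c = ?d \<and> ?G = 0")
proof -
  let ?N = "{j. {i, j} \<in> E}"
  let ?y = "\<lambda>j. \<omega> $ {i, j} / (\<alpha> i * \<alpha> j)"
  have F: "?F = ?c *\<^sub>R q $ Some i + (\<Sum>j\<in>?N. ?y j *\<^sub>R (q $ Some i - q $ Some j))"
    by (simp add: sum_cone_neighbours q_None w)
  have d: "\<alpha> i * ?d = (\<Sum>j\<in>?N. ?y j * (\<alpha> j - \<alpha> i))"
    by (simp add: cone_edge_weight_def scale_nonzero)
  have "snd ?F = ?c * \<alpha> i - (\<Sum>j\<in>?N. ?y j * (\<alpha> j - \<alpha> i))"
    unfolding F by (simp add: q_Some snd_sum right_diff_distrib sum_subtractf)
  then have snd: "snd ?F = \<alpha> i * (?c - ?d)"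
    unfolding d[symmetric] by (simp add: algebra_simps)
  \<comment> \<open>The splitting \<open>\<alpha>\<^sub>i p\<^sub>i - \<alpha>\<^sub>j p\<^sub>j = \<alpha>\<^sub>j (p\<^sub>i - p\<^sub>j) - (\<alpha>\<^sub>j - \<alpha>\<^sub>i) p\<^sub>i\<close>; the second part is
    absorbed by the cone edge.\<close>
  have horizontal: "?y j *\<^sub>R (\<alpha> i *\<^sub>R p $ i - \<alpha> j *\<^sub>R p $ j) =
      (\<omega> $ {i, j} / \<alpha> i) *\<^sub>R (p $ i - p $ j) - (?y j * (\<alpha> j - \<alpha> i)) *\<^sub>R p $ i" for j
    using scale_nonzero[of i] scale_nonzero[of j]
    by (simp add: vec_eq_iff field_simps)
  have "fst ?F = (?c * \<alpha> i) *\<^sub>R p $ i + (\<Sum>j\<in>?N. (\<omega> $ {i, j} / \<alpha> i) *\<^sub>R (p $ i - p $ j))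
      - (\<Sum>j\<in>?N. ?y j * (\<alpha> j - \<alpha> i)) *\<^sub>R p $ i"
    unfolding F by (simp add: q_Some fst_sum horizontal sum_subtractf scaleR_sum_left)
  also have "(\<Sum>j\<in>?N. (\<omega> $ {i, j} / \<alpha> i) *\<^sub>R (p $ i - p $ j)) = ?G /\<^sub>R \<alpha> i"
    by (simp add: scaleR_sum_right divide_inverse mult.commute)
  finally have fst: "fst ?F = (\<alpha> i * (?c - ?d)) *\<^sub>R p $ i + ?G /\<^sub>R \<alpha> i"
    unfolding d[symmetric] by (simp add: algebra_simps)
  show ?thesis
    using scale_nonzero[of i] unfolding prod_eq_iff fst snd by auto
qed

lemma cone_joint_equilibrium:
  assumes "\<And>i. (\<Sum>k | {Some i, k} \<in> cone_graph E. w $ {Some i, k} *\<^sub>R (q $ Some i - q $ k)) = 0"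
  shows "(\<Sum>k | {None, k} \<in> cone_graph E. w $ {None, k} *\<^sub>R (q $ None - q $ k)) = 0"
proof -
  have "(\<Sum>k\<in>UNIV. \<Sum>l | {k, l} \<in> cone_graph E. w $ {k, l} *\<^sub>R (q $ k - q $ l)) = 0"
    by (rule sum_edge_forces)
  then show ?thesis
    using assms by (simp add: UNIV_option_conv sum.reindex)
qed

lemma mink_self_stress_iff:
  "mink_self_stress (cone_graph E) q w \<longleftrightarrow> (\<forall>e. e \<notin> cone_graph E \<longrightarrow> w $ e = 0) \<and>
    (\<forall>i. (\<Sum>k | {Some i, k} \<in> cone_graph E. w $ {Some i, k} *\<^sub>R (q $ Some i - q $ k)) = 0)"
  unfolding mink_self_stress_def mink_equilibrium_iff
  using cone_joint_equilibrium[of w] by (auto simp: split_option_all)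

lemma prod_edge: "{i, j} \<in> E \<Longrightarrow> prod \<alpha> {i, j} = \<alpha> i * \<alpha> j"
  using simple by (cases "i = j") (auto simp: simple_graph_def)

lemma self_stress_cone_stress:
  assumes "self_stress E p \<omega>"
  shows "mink_self_stress (cone_graph E) q (cone_stress E \<alpha> \<omega>)"
  unfolding mink_self_stress_iff
proof (intro conjI allI impI)
  fix e
  assume e: "e \<notin> cone_graph E"
  show "cone_stress E \<alpha> \<omega> $ e = 0"
  proof (cases "None \<in> e")
    case True
    then have "{i. e = {Some i, None}} = {}"
      using e by auto
    with True show ?thesis
      by (simp add: cone_stress_def)
  next
    case False
    then show ?thesis
      using e assms by (simp add: cone_graph_without_None cone_stress_def self_stress_def)
  qed
next
  fix i
  have "cone_stress E \<alpha> \<omega> $ {Some i, Some j} = \<omega> $ {i, j} / (\<alpha> i * \<alpha> j)" if "{i, j} \<in> E" for j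
    using cone_stress_image_Some[of E \<alpha> \<omega> "{i, j}"] prod_edge[OF that] by simp
  from cone_equilibrium_iff[OF this]
  show "(\<Sum>k | {Some i, k} \<in> cone_graph E.
      cone_stress E \<alpha> \<omega> $ {Some i, k} *\<^sub>R (q $ Some i - q $ k)) = 0"
    using assms by (simp add: self_stress_def)
qed

lemma base_stress_edge:
  "{i, j} \<in> E \<Longrightarrow> w $ {Some i, Some j} = base_stress \<alpha> w $ {i, j} / (\<alpha> i * \<alpha> j)"
  using prod_edge[of i j] by (simp add: base_stress_def scale_nonzero)

lemma
  assumes "mink_self_stress (cone_graph E) q w"
  shows self_stress_base_stress: "self_stress E p (base_stress \<alpha> w)"
    and cone_base_stress: "cone_stress E \<alpha> (base_stress \<alpha> w) = w"
proof -
  have zero: "w $ e = 0" if "e \<notin> cone_graph E" for e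
    using assms that unfolding mink_self_stress_iff by blast
  have eq: "w $ {Some i, None} = cone_edge_weight E \<alpha> (base_stress \<alpha> w) i"
    "(\<Sum>j | {i, j} \<in> E. base_stress \<alpha> w $ {i, j} *\<^sub>R (p $ i - p $ j)) = 0" for i
    using assms cone_equilibrium_iff[OF base_stress_edge, of i w]
    unfolding mink_self_stress_iff by blast+
  have "base_stress \<alpha> w $ e = 0" if "e \<notin> E" for e
    using that zero[of "Some ` e"] cone_graph_without_None[of "Some ` e" E]
    by (auto simp: base_stress_def inj_vimage_image_eq)
  with eq(2) show "self_stress E p (base_stress \<alpha> w)"
    unfolding self_stress_def by blast
  have "cone_stress E \<alpha> (base_stress \<alpha> w) $ e = w $ e" for e
  proof (cases "None \<in> e")
    case True
    show ?thesis
    proof (cases "e \<in> cone_graph E")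
      case True
      with \<open>None \<in> e\<close> obtain i where "e = {Some i, None}"
        by (auto simp: cone_graph_with_None)
      then show ?thesis
        by (simp add: eq(1))
    next
      case False
      then have "{i. e = {Some i, None}} = {}"
        by auto
      with True False show ?thesis
        by (simp add: cone_stress_def zero)
    qed
  next
    case False
    then have "Some ` (Some -` e) = e"
      by (auto simp: image_iff) (metis option.exhaust)
    with False show ?thesis
      by (simp add: cone_stress_def base_stress_def scale_nonzero)
  qed
  then show "cone_stress E \<alpha> (base_stress \<alpha> w) = w"
    by (simp add: vec_eq_iff)
qed

lemma base_cone_stress: "base_stress \<alpha> (cone_stress E \<alpha> \<omega>) = \<omega>"
  by (simp add: base_stress_def vec_eq_iff scale_nonzero)

lemma prod_scale_invariant: "x \<in> S \<Longrightarrow> prod \<alpha> (act x ` e) = prod \<alpha> e"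
  using bij_act[of x] by (subst prod.reindex) (auto simp: scale_invariant bij_def inj_on_def)

lemma cone_edge_weight_invariant:
  assumes "symmetric_stress E S p \<omega>" and x: "x \<in> S"
  shows "cone_edge_weight E \<alpha> \<omega> (act x i) = cone_edge_weight E \<alpha> \<omega> i"
proof -
  have edge: "\<omega> $ {act x i, act x j} = \<omega> $ {i, j}" if "{i, j} \<in> E" for j
  proof -
    have "\<omega> $ (act x ` {i, j}) = \<omega> $ {i, j}"
      using assms that unfolding symmetric_stress_iff by blast
    then show ?thesis
      by simp
  qed
  have neighbours: "{j. {act x i, j} \<in> E} = act x ` {j. {i, j} \<in> E}"
  proof (rule Set.set_eqI)
    fix k
    obtain j where k: "k = act x j"
      using bij_act[OF x] by (metis bij_pointE)
    have "act x j \<in> act x ` {j. {i, j} \<in> E} \<longleftrightarrow> {i, j} \<in> E"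
      using inj_image_mem_iff[OF bij_is_inj[OF bij_act[OF x]]] by simp
    then show "k \<in> {j. {act x i, j} \<in> E} \<longleftrightarrow> k \<in> act x ` {j. {i, j} \<in> E}"
      by (simp add: k act_edge[OF x])
  qed
  have "inj_on (act x) {j. {i, j} \<in> E}"
    using bij_is_inj[OF bij_act[OF x]] by (rule inj_on_subset) simp
  then show ?thesis
    unfolding cone_edge_weight_def neighbours
    by (simp add: sum.reindex edge scale_invariant[OF x] cong: sum.cong_simp)
qed

lemma symmetric_cone_stress:
  assumes "symmetric_stress E S p \<omega>"
  shows "symmetric_stress (cone_graph E) (star ` S) q (cone_stress E \<alpha> \<omega>)"
proof -
  have "cone_stress E \<alpha> \<omega> $ (map_option (act x) ` e) = cone_stress E \<alpha> \<omega> $ e"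
    if x: "x \<in> S" and e: "e \<in> cone_graph E" for x e
  proof (cases "None \<in> e")
    case True
    with e obtain i where "e = {Some i, None}"
      by (auto simp: cone_graph_with_None)
    then show ?thesis
      by (simp add: cone_edge_weight_invariant[OF assms x])
  next
    case False
    with e obtain e' where e': "e' \<in> E" "e = Some ` e'"
      by (auto simp: cone_graph_def)
    then have "map_option (act x) ` e = Some ` (act x ` e')"
      by (simp add: image_image)
    with e' show ?thesis
      using assms x by (simp add: symmetric_stress_iff prod_scale_invariant)
  qed
  then show ?thesis
    by (simp add: symmetric_stress_iff cone_action)
qed

lemma symmetric_base_stress:
  assumes "symmetric_stress (cone_graph E) (star ` S) q w"
  shows "symmetric_stress E S p (base_stress \<alpha> w)"
proof -
  have "w $ (Some ` (act x ` e)) = w $ (Some ` e)" if x: "x \<in> S" and e: "e \<in> E" for x e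
  proof -
    have "Some ` e \<in> cone_graph E"
      using e by (simp add: cone_graph_def)
    then have "w $ (map_option (act x) ` (Some ` e)) = w $ (Some ` e)"
      using assms x by (simp add: symmetric_stress_iff cone_action)
    then show ?thesis
      by (simp add: image_image)
  qed
  then show ?thesis
    by (simp add: symmetric_stress_iff base_stress_def prod_scale_invariant)
qed

lemma bij_betw_cone_stress:
  "bij_betw (cone_stress E \<alpha>) (symmetric_stresses E S p)
    (mink_symmetric_stresses (cone_graph E) (star ` S) q)"
  by (rule bij_betw_byWitness[where f' = "base_stress \<alpha>"])
    (auto simp: symmetric_stresses_def mink_symmetric_stresses_def base_cone_stress
      cone_base_stress self_stress_cone_stress self_stress_base_stress
      symmetric_cone_stress symmetric_base_stress)

end

lemma subspace_symmetric_stresses: "subspace (symmetric_stresses E S p)"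
  unfolding symmetric_stresses_def subspace_def self_stress_def symmetric_stress_def
  by (auto simp: scaleR_add_left sum.distrib simp flip: scaleR_scaleR scaleR_sum_right)

theorem theorem5p3:
  fixes E :: "'v::finite set set"
    and S :: "(real^'d::finite \<Rightarrow> real^'d) set"
    and p :: "(real^'d)^'v"
    and q :: "((real^'d) \<times> real)^('v option)"
  assumes "subgroup S orthogonal_group"
    and "p \<in> symmetric_frameworks E S"
    and "q $ None = 0"
    and "q \<in> symmetric_frameworks (cone_graph E) (star ` S)"
    and "projects_to q p"
  shows
    "isomorphic_spaces (symmetric_motions E S p)
       {u \<in> mink_symmetric_motions (cone_graph E) (star ` S) q. u $ None = 0} \<and>
     isomorphic_spaces {u \<in> symmetric_motions E S p. trivial_motion p u}
       {u \<in> mink_symmetric_motions (cone_graph E) (star ` S) q.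
          mink_trivial_motion q u \<and> u $ None = 0} \<and>
     ((\<exists>u \<in> symmetric_motions E S p. \<not> trivial_motion p u) \<longleftrightarrow>
      (\<exists>u \<in> mink_symmetric_motions (cone_graph E) (star ` S) q. \<not> mink_trivial_motion q u)) \<and>
     isomorphic_spaces (symmetric_stresses E S p)
       (mink_symmetric_stresses (cone_graph E) (star ` S) q)"
proof -
  have "\<exists>\<alpha>. \<forall>i. \<alpha> i \<noteq> 0 \<and> q $ Some i = \<alpha> i *\<^sub>R (p $ i, 1)"
    using assms(5) unfolding projects_to_def by metis
  then obtain \<alpha> where \<alpha>: "\<And>i. \<alpha> i \<noteq> 0" "\<And>i. q $ Some i = \<alpha> i *\<^sub>R (p $ i, 1)"
    by blast
  have "orthogonal_transformation x" if "x \<in> S" for x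
    using subgroup.subset[OF assms(1)] that by (auto simp: orthogonal_group_def)
  then interpret coned_framework E S p q \<alpha>
    using assms \<alpha> by unfold_locales auto
  have "subspace {u \<in> symmetric_motions E S p. trivial_motion p u}"
    using subspace_inter[OF subspace_symmetric_motions subspace_trivial_motions]
    by (simp add: Int_def)
  then show ?thesis
    using nontrivial_motion_iff
    by (intro conjI isomorphic_spacesI[OF _ linear_cone_velocity bij_betw_cone_velocity]
        isomorphic_spacesI[OF _ linear_cone_velocity bij_betw_cone_velocity_trivial]
        isomorphic_spacesI[OF _ linear_cone_stress bij_betw_cone_stress]
        subspace_symmetric_motions subspace_symmetric_stresses)
qed

end
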